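(* Let $\mathscr A$ be a $C^*$-algebra, let $\mathscr E$ be a Hilbert $C^*$-module over $\mathscr A$, and let $\Pi_1,\Pi_2\in\mathcal L(\mathscr E)$ be idempotents satisfying $\Pi_1\Pi_2=\Pi_2\Pi_1=0$. Then for every $\lambda\in\mathbb C\setminus\{0\}$, $$(\Pi_1+\lambda\Pi_2)^\dagger=(\Pi_1+\Pi_2)^\dagger\left(\Pi_1+\frac1\lambda\Pi_2\right)(\Pi_1+\Pi_2)^\dagger$$ (in particular, the Moore--Penrose inverses appearing here exist).
   Context: $\mathcal L(\mathscr E)$ is the set of all adjointable operators on $\mathscr E$. An idempotent is an operator $\Pi$ with $\Pi^2=\Pi$ (not necessarily self-adjoint). The Moore--Penrose inverse $T^\dagger$ of $T\in\mathcal L(\mathscr E)$, when it exists, is the unique $X\in\mathcal L(\mathscr E)$ satisfying $TXT=T$, $XTX=X$, $(TX)^*=TX$ and $(XT)^*=XT$. *)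

theory Defs
  imports "HOL-Analysis.Analysis"
begin

section \<open>Complex normed spaces and C*-algebras\<close>

class scaleC = scaleR +
  fixes scaleC :: "complex \<Rightarrow> 'a \<Rightarrow> 'a" (infixr "*\<^sub>C" 75)
  assumes scaleR_scaleC: "scaleR r x = complex_of_real r *\<^sub>C x"

class complex_vector = scaleC + ab_group_add +
  assumes scaleC_add_right: "c *\<^sub>C (x + y) = c *\<^sub>C x + c *\<^sub>C y"
    and scaleC_add_left: "(c + d) *\<^sub>C x = c *\<^sub>C x + d *\<^sub>C x"
    and scaleC_scaleC: "c *\<^sub>C (d *\<^sub>C x) = (c * d) *\<^sub>C x"
    and scaleC_one: "1 *\<^sub>C x = x"

class complex_normed_vector = complex_vector + real_normed_vector +
  assumes norm_scaleC: "norm (c *\<^sub>C x) = cmod c * norm x"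

text \<open>No unit is required: the class \<open>real_normed_algebra\<close> does not include one.\<close>

class cstar_algebra = complex_normed_vector + real_normed_algebra + banach +
  fixes star :: "'a \<Rightarrow> 'a"
  assumes mult_scaleC_left: "(c *\<^sub>C a) * b = c *\<^sub>C (a * b)"
    and mult_scaleC_right: "a * (c *\<^sub>C b) = c *\<^sub>C (a * b)"
    and star_star: "star (star a) = a"
    and star_add: "star (a + b) = star a + star b"
    and star_scaleC: "star (c *\<^sub>C a) = cnj c *\<^sub>C star a"
    and star_mult: "star (a * b) = star b * star a"
    and cstar_identity: "norm (star a * a) = (norm a)\<^sup>2"

definition cstar_positive :: "'a::cstar_algebra \<Rightarrow> bool"
  where "cstar_positive a \<longleftrightarrow> (\<exists>b. a = star b * b)"


section \<open>Hilbert C*-modules\<close>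

text \<open>
  Right Hilbert modules, with \<open>act x a\<close> the product of \<open>x\<close> by the scalar \<open>a\<close> and the
  inner product linear in its second argument. The class \<open>banach\<close> supplies
  completeness; \<open>norm_eq\<close> makes the ambient norm the one induced by the inner product.
\<close>

locale hilbert_cstar_module =
  fixes act :: "'e::{complex_normed_vector, banach} \<Rightarrow> 'a::cstar_algebra \<Rightarrow> 'e"
    and ip :: "'e \<Rightarrow> 'e \<Rightarrow> 'a"
  assumes act_add_left: "act (x + y) a = act x a + act y a"
    and act_add_right: "act x (a + b) = act x a + act x b"
    and act_mult: "act x (a * b) = act (act x a) b"
    and act_scaleC_left: "act (c *\<^sub>C x) a = c *\<^sub>C act x a"
    and act_scaleC_right: "act x (c *\<^sub>C a) = c *\<^sub>C act x a"
    and ip_add: "ip x (y + z) = ip x y + ip x z"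
    and ip_scaleC: "ip x (c *\<^sub>C y) = c *\<^sub>C ip x y"
    and ip_act: "ip x (act y a) = ip x y * a"
    and ip_star: "ip y x = star (ip x y)"
    and ip_positive: "cstar_positive (ip x x)"
    and ip_definite: "ip x x = 0 \<Longrightarrow> x = 0"
    and norm_eq: "norm x = sqrt (norm (ip x x))"


section \<open>Adjointable operators, idempotents and Moore--Penrose inverses\<close>

definition is_adjoint :: "('e \<Rightarrow> 'e \<Rightarrow> 'a) \<Rightarrow> ('e \<Rightarrow> 'e) \<Rightarrow> ('e \<Rightarrow> 'e) \<Rightarrow> bool"
  where "is_adjoint ip T S \<longleftrightarrow> (\<forall>x y. ip (T x) y = ip x (S y))"

definition adjointable :: "('e \<Rightarrow> 'e \<Rightarrow> 'a) \<Rightarrow> ('e \<Rightarrow> 'e) set"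
  where "adjointable ip = {T. \<exists>S. is_adjoint ip T S}"

definition adj :: "('e \<Rightarrow> 'e \<Rightarrow> 'a) \<Rightarrow> ('e \<Rightarrow> 'e) \<Rightarrow> ('e \<Rightarrow> 'e)"
  where "adj ip T = (THE S. is_adjoint ip T S)"

definition idempotent :: "('e \<Rightarrow> 'e) \<Rightarrow> bool"
  where "idempotent P \<longleftrightarrow> P \<circ> P = P"

definition is_mp_inverse :: "('e \<Rightarrow> 'e \<Rightarrow> 'a) \<Rightarrow> ('e \<Rightarrow> 'e) \<Rightarrow> ('e \<Rightarrow> 'e) \<Rightarrow> bool"
  where "is_mp_inverse ip T X \<longleftrightarrow>
    X \<in> adjointable ip \<and>
    T \<circ> X \<circ> T = T \<and> X \<circ> T \<circ> X = X \<and>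
    adj ip (T \<circ> X) = T \<circ> X \<and> adj ip (X \<circ> T) = X \<circ> T"

definition mp_invertible :: "('e \<Rightarrow> 'e \<Rightarrow> 'a) \<Rightarrow> ('e \<Rightarrow> 'e) \<Rightarrow> bool"
  where "mp_invertible ip T \<longleftrightarrow> (\<exists>X. is_mp_inverse ip T X)"

definition mp_inverse :: "('e \<Rightarrow> 'e \<Rightarrow> 'a) \<Rightarrow> ('e \<Rightarrow> 'e) \<Rightarrow> ('e \<Rightarrow> 'e)"
  where "mp_inverse ip T = (THE X. is_mp_inverse ip T X)"

text \<open>Adjoints and Moore--Penrose inverses are unique, so both \<open>THE\<close>s are well-defined.\<close>

context hilbert_cstar_module
begin

lemma ip_diff: "ip x (y - z) = ip x y - ip x z"
  by (metis add_diff_cancel_right' diff_add_cancel ip_add)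

lemma ip_eqI:
  assumes "\<And>x. ip x y = ip x z"
  shows "y = z"
proof -
  have "ip (y - z) (y - z) = 0"
    by (simp add: ip_diff assms)
  then show ?thesis
    using ip_definite by fastforce
qed

lemma is_adjoint_unique:
  assumes "is_adjoint ip T S" "is_adjoint ip T S'"
  shows "S = S'"
proof
  fix y
  show "S y = S' y"
    using assms by (intro ip_eqI) (metis is_adjoint_def)
qed

lemma adj_eqI: "is_adjoint ip T S \<Longrightarrow> adj ip T = S"
  unfolding adj_def using is_adjoint_unique by blast

lemma is_adjoint_adj: "T \<in> adjointable ip \<Longrightarrow> is_adjoint ip T (adj ip T)"
  using adj_eqI by (auto simp: adjointable_def)

lemma is_adjoint_comp:
  assumes "is_adjoint ip T T'" "is_adjoint ip S S'"
  shows "is_adjoint ip (T \<circ> S) (S' \<circ> T')"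
  using assms by (simp add: is_adjoint_def)

lemma adjointable_comp:
  "T \<in> adjointable ip \<Longrightarrow> S \<in> adjointable ip \<Longrightarrow> T \<circ> S \<in> adjointable ip"
  using is_adjoint_comp unfolding adjointable_def by blast

lemma adj_comp:
  "T \<in> adjointable ip \<Longrightarrow> S \<in> adjointable ip \<Longrightarrow> adj ip (T \<circ> S) = adj ip S \<circ> adj ip T"
  by (intro adj_eqI is_adjoint_comp is_adjoint_adj)

lemma is_mp_inverse_unique:
  assumes T: "T \<in> adjointable ip"
    and X: "is_mp_inverse ip T X" and Y: "is_mp_inverse ip T Y"
  shows "X = Y"
proof -
  note X' = X[unfolded is_mp_inverse_def] and Y' = Y[unfolded is_mp_inverse_def]
  have adjbl: "T \<circ> X \<in> adjointable ip" "T \<circ> Y \<in> adjointable ip"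
    "X \<circ> T \<in> adjointable ip" "Y \<circ> T \<in> adjointable ip"
    using T X' Y' by (auto intro: adjointable_comp)
  have "T \<circ> X = adj ip ((T \<circ> Y) \<circ> (T \<circ> X))"
    using X' Y' by (metis comp_assoc)
  also have "\<dots> = (T \<circ> X) \<circ> (T \<circ> Y)"
    using X' Y' adj_comp[OF adjbl(2,1)] by simp
  also have "\<dots> = T \<circ> Y"
    using X' by (metis comp_assoc)
  finally have TX: "T \<circ> X = T \<circ> Y" .
  have "X \<circ> T = adj ip ((X \<circ> T) \<circ> (Y \<circ> T))"
    using X' Y' by (metis comp_assoc)
  also have "\<dots> = (Y \<circ> T) \<circ> (X \<circ> T)"
    using X' Y' adj_comp[OF adjbl(3,4)] by simp
  also have "\<dots> = Y \<circ> T"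
    using X' by (metis comp_assoc)
  finally have XT: "X \<circ> T = Y \<circ> T" .
  show ?thesis
    using X' Y' TX XT by (metis comp_assoc)
qed

lemma mp_inverse_eqI:
  "T \<in> adjointable ip \<Longrightarrow> is_mp_inverse ip T X \<Longrightarrow> mp_inverse ip T = X"
  unfolding mp_inverse_def using is_mp_inverse_unique by blast

end

end

theory Submission
  imports Defs
begin

text \<open>
  Put \<open>P = \<Pi>\<^sub>1 + \<Pi>\<^sub>2\<close>. Orthogonality of the two idempotents makes \<open>P\<close> an idempotent, and makes
  \<open>T = \<Pi>\<^sub>1 + l \<Pi>\<^sub>2\<close> invertible in the corner \<open>P \<L> P\<close>, with inverse \<open>G = \<Pi>\<^sub>1 + (1/l) \<Pi>\<^sub>2\<close>:
  \<open>TG = GT = P\<close>. If \<open>X\<close> is a Moore--Penrose inverse of \<open>P\<close>, then \<open>T(XGX) = PX\<close> and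
  \<open>(XGX)T = XP\<close>, because the copies of \<open>P\<close> that \<open>T\<close> and \<open>G\<close> absorb cancel the factors \<open>X\<close>
  between them (\<open>is_mp_inverse_corner\<close>). So \<open>XGX\<close> has the same range and support projections
  as \<open>X\<close>, which gives the formula. The content that remains is the existence of \<open>X\<close>.

  For an idempotent \<open>P\<close> the operator \<open>S = P + P\<^sup>* - 1\<close> satisfies \<open>SP = P\<^sup>*S\<close> and
  \<open>PS = SP\<^sup>* = PP\<^sup>*\<close>. Once \<open>S\<close> is invertible, \<open>PS\<^sup>-\<^sup>1\<close> and \<open>S\<^sup>-\<^sup>1P\<close> are therefore self-adjoint
  and \<open>S\<^sup>-\<^sup>1PS\<^sup>-\<^sup>1\<close> is a Moore--Penrose inverse of \<open>P\<close> (\<open>mp_inverse_idempotent_exists\<close>).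
  Invertibility of \<open>S\<close> comes from \<open>S\<^sup>2 = 1 - D\<^sup>2 = (1 - D)(1 + D)\<close> with \<open>D = P - P\<^sup>*\<close>
  skew-adjoint.

  It is usual to invert \<open>1 - D\<^sup>2 = 1 + D\<^sup>*D\<close> by the order structure of a C*-algebra. Here
  the factors \<open>1 - D\<close> and \<open>1 + D\<close> are inverted separately, by a Hille--Yosida argument that uses
  norms only. A skew-adjoint operator generates isometries to first order,
  \<open>\<parallel>x - hDx\<parallel> \<ge> \<parallel>x\<parallel> - O(h\<^sup>2)\<close>, and this forces \<open>\<parallel>(r - D)x\<parallel> \<ge> r\<parallel>x\<parallel>\<close> for \<open>r > 0\<close>
  (\<open>skew_adjoint_dissipative\<close>). For large \<open>r\<close> the operator \<open>r - D\<close> is onto because \<open>D\<close> is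
  bounded, and the resolvent estimate allows \<open>r\<close> to be halved as often as needed until it
  reaches \<open>1\<close> (\<open>bij_one_minus_skew_adjoint\<close>). Boundedness of adjointable operators is the
  Hellinger--Toeplitz theorem, obtained from Baire's theorem and a crude Cauchy--Schwarz
  inequality that only needs polarization.
\<close>

section \<open>Norm estimates for the inner product\<close>

lemma scaleC_0_right: "c *\<^sub>C (0::'a::complex_vector) = 0"
  by (metis add_cancel_left_left scaleC_add_right)

lemma scaleC_minus_right: "c *\<^sub>C (- x :: 'a::complex_vector) = - (c *\<^sub>C x)"
  by (metis add.right_inverse add_eq_0_iff scaleC_0_right scaleC_add_right)

context hilbert_cstar_module
begin

lemma norm_ip_self: "norm (ip x x) = (norm x)\<^sup>2"
  by (simp add: norm_eq)

lemma ip_add_left: "ip (x + y) z = ip x z + ip y z"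
  by (metis ip_add ip_star star_add)

lemma ip_scaleC_left: "ip (c *\<^sub>C x) y = cnj c *\<^sub>C ip x y"
  by (metis ip_scaleC ip_star star_scaleC)

lemma ip_scaleR: "ip x (r *\<^sub>R y) = r *\<^sub>R ip x y"
  by (simp add: scaleR_scaleC ip_scaleC)

lemma ip_scaleR_left: "ip (r *\<^sub>R x) y = r *\<^sub>R ip x y"
  by (simp add: scaleR_scaleC ip_scaleC_left)

lemma ip_minus: "ip x (- y) = - ip x y"
  using ip_scaleR[of x "-1" y] by simp

lemma ip_minus_left: "ip (- x) y = - ip x y"
  using ip_scaleR_left[of "-1" x y] by simp

lemma ip_diff_left: "ip (x - y) z = ip x z - ip y z"
  using ip_add_left[of x "- y" z] by (simp add: ip_minus_left)

lemma ip_zero: "ip x 0 = 0"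
  using ip_diff[of x 0 0] by simp

lemma ip_zero_left: "ip 0 x = 0"
  using ip_diff_left[of 0 0 x] by simp

lemma norm_ip_symmetrized_le: "norm (ip x y + ip y x) \<le> (norm x + norm y)\<^sup>2"
proof -
  have eq: "ip (x + y) (x + y) - ip (x - y) (x - y) = 2 *\<^sub>R (ip x y + ip y x)"
    by (simp add: ip_add ip_diff ip_add_left ip_diff_left scaleR_2 algebra_simps)
  have "2 * norm (ip x y + ip y x) = norm (ip (x + y) (x + y) - ip (x - y) (x - y))"
    unfolding eq by simp
  also have "\<dots> \<le> (norm (x + y))\<^sup>2 + (norm (x - y))\<^sup>2"
    using norm_triangle_ineq4[of "ip (x + y) (x + y)" "ip (x - y) (x - y)"]
    by (simp add: norm_ip_self)
  also have "\<dots> \<le> (norm x + norm y)\<^sup>2 + (norm x + norm y)\<^sup>2"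
    by (intro add_mono power_mono norm_triangle_ineq norm_triangle_ineq4 norm_ge_zero)
  finally show ?thesis
    by simp
qed

text \<open>
  The symmetrized bound holds for \<open>ip x y + ip y x\<close>; multiplying \<open>x\<close> by \<open>\<i>\<close> turns it into the
  same bound for \<open>ip x y - ip y x\<close>. The sharp Cauchy--Schwarz constant would need positivity
  in the C*-algebra, whereas any constant serves for the topology.
\<close>

lemma norm_ip_le: "norm (ip x y) \<le> 4 * norm x * norm y"
proof -
  have quad: "norm (ip x y) \<le> (norm x + norm y)\<^sup>2" for x y
  proof -
    have "ip (\<i> *\<^sub>C x) y + ip y (\<i> *\<^sub>C x) = \<i> *\<^sub>C (ip y x - ip x y)"
    proof -
      have "ip (\<i> *\<^sub>C x) y = - (\<i> *\<^sub>C ip x y)"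
        by (metis add.right_inverse add_eq_0_iff cnj.code complex_cnj_i ip_scaleC_left
            scaleC_add_left scaleR_scaleC scaleR_zero_left of_real_0)
      then show ?thesis
        using scaleC_add_right[of \<i> "ip y x" "- ip x y"]
        by (simp add: ip_scaleC scaleC_minus_right)
    qed
    then have "norm (ip x y - ip y x) \<le> (norm x + norm y)\<^sup>2"
      using norm_ip_symmetrized_le[of "\<i> *\<^sub>C x" y]
      by (simp add: norm_scaleC norm_minus_commute)
    moreover have "norm (ip x y + ip y x) \<le> (norm x + norm y)\<^sup>2"
      by (rule norm_ip_symmetrized_le)
    moreover have "2 * norm (ip x y) \<le> norm (ip x y + ip y x) + norm (ip x y - ip y x)"
    proof -
      have "(ip x y + ip y x) + (ip x y - ip y x) = 2 *\<^sub>R ip x y"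
        by (simp add: scaleR_2)
      then show ?thesis
        by (metis norm_triangle_ineq norm_scaleR abs_numeral)
    qed
    ultimately show ?thesis
      by linarith
  qed
  show ?thesis
  proof (cases "x = 0 \<or> y = 0")
    case False
    have "norm (ip (sgn x) (sgn y)) \<le> 4"
      using quad[of "sgn x" "sgn y"] False by (simp add: norm_sgn)
    then show ?thesis
      using False by (simp add: sgn_div_norm ip_scaleR ip_scaleR_left field_simps)
  qed (auto simp: ip_zero ip_zero_left)
qed

lemma continuous_on_norm_ip: "continuous_on UNIV (\<lambda>x. norm (ip z x))"
proof -
  have "bounded_linear (ip z)"
    by (rule bounded_linear_intro[where K = "4 * norm z"])
      (use norm_ip_le[of z] in \<open>auto simp: ip_add ip_scaleR ac_simps\<close>)
  then show ?thesis
    by (intro continuous_intros linear_continuous_on)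
qed

section \<open>Adjointable operators are linear and bounded\<close>

lemma is_adjoint_sym: "is_adjoint ip T S \<Longrightarrow> is_adjoint ip S T"
  unfolding is_adjoint_def by (metis ip_star)

lemma is_adjoint_add:
  "is_adjoint ip T T' \<Longrightarrow> is_adjoint ip S S' \<Longrightarrow> is_adjoint ip (\<lambda>x. T x + S x) (\<lambda>x. T' x + S' x)"
  by (simp add: is_adjoint_def ip_add ip_add_left)

lemma is_adjoint_diff:
  "is_adjoint ip T T' \<Longrightarrow> is_adjoint ip S S' \<Longrightarrow> is_adjoint ip (\<lambda>x. T x - S x) (\<lambda>x. T' x - S' x)"
  by (simp add: is_adjoint_def ip_diff ip_diff_left)

lemma is_adjoint_scaleC: "is_adjoint ip T T' \<Longrightarrow> is_adjoint ip (\<lambda>x. c *\<^sub>C T x) (\<lambda>x. cnj c *\<^sub>C T' x)"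
  by (simp add: is_adjoint_def ip_scaleC ip_scaleC_left)

lemma is_adjoint_ident: "is_adjoint ip (\<lambda>x. x) (\<lambda>x. x)"
  by (simp add: is_adjoint_def)

lemma adjointable_add_scaleC:
  assumes "T \<in> adjointable ip" "S \<in> adjointable ip"
  shows "(\<lambda>x. T x + c *\<^sub>C S x) \<in> adjointable ip"
  using assms is_adjoint_add[OF _ is_adjoint_scaleC] unfolding adjointable_def by blast

lemma is_adjoint_additive:
  assumes "is_adjoint ip T S"
  shows "T (x + y) = T x + T y"
  using is_adjoint_sym[OF assms] by (intro ip_eqI) (metis is_adjoint_def ip_add)

lemma is_adjoint_homogeneous:
  assumes "is_adjoint ip T S"
  shows "T (c *\<^sub>C x) = c *\<^sub>C T x"
  using is_adjoint_sym[OF assms] by (intro ip_eqI) (metis is_adjoint_def ip_scaleC)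

lemma is_adjoint_linear:
  assumes "is_adjoint ip T S"
  shows "linear T"
  by (rule linearI) (simp_all add: scaleR_scaleC is_adjoint_additive[OF assms]
      is_adjoint_homogeneous[OF assms])

text \<open>
  Hellinger--Toeplitz. The functionals \<open>ip (T y)\<close>, for \<open>y\<close> in the unit ball, are bounded at each
  point \<open>x\<close> since \<open>ip (T y) x = ip y (S x)\<close>; by Baire they are uniformly bounded on some ball, and
  testing them on a multiple of \<open>T y\<close> itself bounds \<open>norm (T y)\<close>.
\<close>

lemma is_adjoint_bounded:
  assumes adj: "is_adjoint ip T S"
  obtains M where "0 \<le> M" "\<And>x. norm (T x) \<le> M * norm x"
proof -
  define A where "A n = {x. \<forall>y. norm y \<le> 1 \<longrightarrow> norm (ip (T y) x) \<le> real n}" for n :: nat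
  have closed: "closed (A n)" for n
  proof -
    have "A n = (\<Inter>y\<in>{y. norm y \<le> 1}. {x. norm (ip (T y) x) \<le> real n})"
      by (auto simp: A_def)
    then show ?thesis
      by (auto intro!: closed_INT closed_Collect_le continuous_on_norm_ip continuous_intros)
  qed
  have cover: "(\<Union>n. A n) = UNIV"
  proof -
    have "\<exists>n. x \<in> A n" for x
    proof -
      obtain n where n: "4 * norm (S x) \<le> real n"
        using real_arch_simple by blast
      have "norm (ip (T y) x) \<le> real n" if "norm y \<le> 1" for y
      proof -
        have "norm (ip (T y) x) \<le> 4 * norm y * norm (S x)"
          using adj norm_ip_le[of y "S x"] by (simp add: is_adjoint_def)
        also have "\<dots> \<le> 4 * norm (S x)"
          using mult_right_mono[OF that norm_ge_zero[of "S x"]] by simp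
        finally show ?thesis using n by simp
      qed
      then show ?thesis by (auto simp: A_def)
    qed
    then show ?thesis by auto
  qed
  have "\<exists>n. interior (A n) \<noteq> {}"
  proof (rule ccontr)
    assume "\<not> ?thesis"
    then have "euclidean interior_of \<Union>(range A) = {}"
      using closed by (intro Baire_category_alt)
        (auto simp: completely_metrizable_space_euclidean)
    then show False
      using cover by simp
  qed
  then obtain n x0 r where r: "r > 0" "ball x0 r \<subseteq> A n"
    by (meson all_not_in_conv mem_interior)
  \<comment> \<open>The ball is centred at \<open>x0\<close>; differences recentre it at the origin at the cost of a factor 2.\<close>
  have small: "norm (ip (T y) x) \<le> 2 * real n" if "norm y \<le> 1" "norm x < r" for x y
  proof -
    have "x0 + x \<in> A n" "x0 \<in> A n"
      using r that by (auto simp: subset_iff dist_norm)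
    then have "norm (ip (T y) (x0 + x)) \<le> n" "norm (ip (T y) x0) \<le> n"
      using that by (auto simp: A_def)
    moreover have "ip (T y) x = ip (T y) (x0 + x) - ip (T y) x0"
      by (simp add: ip_add)
    ultimately show ?thesis
      using norm_triangle_ineq4[of "ip (T y) (x0 + x)" "ip (T y) x0"] by simp
  qed
  define M where "M = 4 * real n / r"
  have unit: "norm (T y) \<le> M" if y: "norm y \<le> 1" for y
  proof (cases "T y = 0")
    case False
    have "norm (ip (T y) ((r / 2) *\<^sub>R sgn (T y))) \<le> 2 * real n"
      using r False by (intro small y) (simp add: norm_sgn)
    also have "ip (T y) ((r / 2) *\<^sub>R sgn (T y)) = (r / 2 / norm (T y)) *\<^sub>R ip (T y) (T y)"
      by (simp only: sgn_div_norm ip_scaleR scaleR_scaleR divide_inverse)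
    also have "norm \<dots> = r / 2 * norm (T y)"
      using r False by (simp add: norm_ip_self power2_eq_square)
    finally show ?thesis
      using r by (simp add: M_def field_simps)
  qed (use r in \<open>simp add: M_def\<close>)
  have "norm (T x) \<le> M * norm x" for x
  proof (cases "x = 0")
    case True
    then show ?thesis by (simp add: linear_0[OF is_adjoint_linear[OF adj]])
  next
    case False
    have "norm (T (sgn x)) \<le> M"
      by (rule unit) (use False in \<open>simp add: norm_sgn\<close>)
    then show ?thesis
      using False
      by (simp add: sgn_div_norm linear_cmul[OF is_adjoint_linear[OF adj]] field_simps)
  qed
  moreover have "0 \<le> M"
    using r by (simp add: M_def)
  ultimately show ?thesis
    using that by blast
qed

section \<open>Skew-adjoint operators\<close>

text \<open>
  For \<open>h > 0\<close> the cross terms of \<open>ip (x - h D x) (x - h D x)\<close> cancel, so the norm of \<open>x - h D x\<close>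
  is \<open>norm x\<close> up to order \<open>h\<^sup>2\<close>. As \<open>x - h D x = h (r x - D x) + (1 - r h) x\<close>, comparison of
  the terms of first order in \<open>h\<close> gives the claim.
\<close>

lemma skew_adjoint_dissipative:
  assumes skew: "is_adjoint ip D (\<lambda>x. - D x)" and r: "0 < r"
  shows "r * norm x \<le> norm (r *\<^sub>R x - D x)"
proof -
  define a d m where "a = norm x" and "d = norm (D x)" and "m = norm (r *\<^sub>R x - D x)"
  define K where "K = d\<^sup>2 + m\<^sup>2 + r\<^sup>2 * a\<^sup>2"
  have pos: "0 \<le> a" "0 \<le> d" "0 \<le> m"
    by (auto simp: a_def d_def m_def)
  have approx: "r * a\<^sup>2 \<le> m * a + h * K" if h: "0 < h" "h \<le> 1 / r" for h
  proof -
    have rh: "r * h \<le> 1"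
      using h r by (simp add: field_simps)
    have "ip (D x) x = - ip x (D x)"
      using skew by (simp add: is_adjoint_def ip_minus)
    then have "ip (x - h *\<^sub>R D x) (x - h *\<^sub>R D x) = ip x x + h\<^sup>2 *\<^sub>R ip (D x) (D x)"
      by (simp add: ip_diff ip_diff_left ip_scaleR ip_scaleR_left power2_eq_square scaleR_diff_right)
    then have "ip x x = ip (x - h *\<^sub>R D x) (x - h *\<^sub>R D x) - h\<^sup>2 *\<^sub>R ip (D x) (D x)"
      by simp
    then have "norm (ip x x)
        \<le> norm (ip (x - h *\<^sub>R D x) (x - h *\<^sub>R D x)) + norm (h\<^sup>2 *\<^sub>R ip (D x) (D x))"
      by (metis norm_triangle_ineq4)
    then have lower: "a\<^sup>2 \<le> (norm (x - h *\<^sub>R D x))\<^sup>2 + h\<^sup>2 * d\<^sup>2"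
      by (simp add: norm_ip_self a_def d_def)
    have "x - h *\<^sub>R D x = h *\<^sub>R (r *\<^sub>R x - D x) + (1 - r * h) *\<^sub>R x"
      by (simp add: algebra_simps)
    then have "norm (x - h *\<^sub>R D x) \<le> h * m + (1 - r * h) * a"
      using norm_triangle_ineq[of "h *\<^sub>R (r *\<^sub>R x - D x)" "(1 - r * h) *\<^sub>R x"] h rh
      by (simp add: a_def m_def)
    then have "(norm (x - h *\<^sub>R D x))\<^sup>2 \<le> (h * m + (1 - r * h) * a)\<^sup>2"
      by (intro power_mono) auto
    \<comment> \<open>Here \<open>a\<^sup>2\<close> cancels, so that the remainder can be divided by \<open>h\<close>.\<close>
    with lower have "a\<^sup>2 \<le> (h * m + (1 - r * h) * a)\<^sup>2 + h\<^sup>2 * d\<^sup>2"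
      by linarith
    then have "h * (2 * (r * a\<^sup>2)) \<le> h * (2 * (m * a) + h * K - 2 * h * r * m * a)"
      by (simp add: K_def power2_eq_square algebra_simps)
    then have "2 * (r * a\<^sup>2) \<le> 2 * (m * a) + h * K - 2 * h * r * m * a"
      using h by simp
    moreover have "0 \<le> 2 * h * r * m * a" "0 \<le> h * K"
      using h r pos by (simp_all add: K_def)
    ultimately show ?thesis
      by linarith
  qed
  have "r * a\<^sup>2 \<le> m * a"
  proof (rule tendsto_lowerbound)
    show "((\<lambda>h. m * a + h * K) \<longlongrightarrow> m * a) (at_right 0)"
      by (auto intro!: tendsto_eq_intros)
    have "\<forall>\<^sub>F h in at_right 0. 0 < h \<and> h \<le> 1 / r"
      using r by (auto simp: eventually_at_right_field intro!: exI[of _ "1 / r"])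
    then show "\<forall>\<^sub>F h in at_right 0. r * a\<^sup>2 \<le> m * a + h * K"
      by eventually_elim (use approx in auto)
  qed simp
  then have "(r * a) * a \<le> m * a"
    by (simp add: power2_eq_square mult.assoc)
  then have "a = 0 \<or> r * a \<le> m"
    using pos by (cases "a = 0") (auto simp: mult_le_cancel_right)
  then show ?thesis
    by (auto simp: a_def m_def)
qed

text \<open>
  Both surjectivity steps are contractions of ratio \<open>1/2\<close>: at a power of two beyond \<open>2 \<parallel>D\<parallel>\<close>, the
  equation is \<open>u = (y + D u) / r\<close>; from \<open>r\<close> to \<open>r / 2\<close>, it is \<open>u = (r - D)\<^sup>-\<^sup>1 (y + (r / 2) u)\<close>, where
  dissipativity bounds the resolvent by \<open>1 / r\<close> uniformly, so that halving never gets harder.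
\<close>

lemma bij_one_minus_skew_adjoint:
  assumes skew: "is_adjoint ip D (\<lambda>x. - D x)"
  shows "bij (\<lambda>x. x - D x)"
proof -
  note lin = is_adjoint_linear[OF skew]
  obtain M where M: "0 \<le> M" "\<And>x. norm (D x) \<le> M * norm x"
    using is_adjoint_bounded[OF skew] by blast
  have expand: "r * norm (u - v) \<le> norm ((r *\<^sub>R u - D u) - (r *\<^sub>R v - D v))" if "0 < r" for r u v
    using skew_adjoint_dissipative[OF skew that, of "u - v"]
    by (simp add: linear_diff[OF lin] algebra_simps)
  have halve: "surj (\<lambda>x. (r / 2) *\<^sub>R x - D x)" if r: "0 < r" and sur: "surj (\<lambda>x. r *\<^sub>R x - D x)" for r
    unfolding surj_def
  proof
    fix y
    obtain g where g: "\<And>z. r *\<^sub>R g z - D (g z) = z"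
      using sur that[of "inv (\<lambda>x. r *\<^sub>R x - D x)"] surj_f_inv_f[OF sur] by simp
    have "dist (g (y + (r / 2) *\<^sub>R u)) (g (y + (r / 2) *\<^sub>R v)) \<le> 1 / 2 * dist u v" for u v
    proof -
      have "r * norm (g (y + (r / 2) *\<^sub>R u) - g (y + (r / 2) *\<^sub>R v)) \<le> norm ((r / 2) *\<^sub>R (u - v))"
        using expand[OF r, of "g (y + (r / 2) *\<^sub>R u)" "g (y + (r / 2) *\<^sub>R v)"]
        by (simp add: g algebra_simps)
      then have "r * norm (g (y + (r / 2) *\<^sub>R u) - g (y + (r / 2) *\<^sub>R v)) \<le> r * (1 / 2 * norm (u - v))"
        using r by simp
      then show ?thesis
        using r by (simp only: dist_norm mult_le_cancel_left_pos)
    qed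
    then obtain u where u: "g (y + (r / 2) *\<^sub>R u) = u"
      using banach_fix_type[of "1 / 2" "\<lambda>u. g (y + (r / 2) *\<^sub>R u)"] by auto
    have "r *\<^sub>R u - D u = y + (r / 2) *\<^sub>R u"
      using g[of "y + (r / 2) *\<^sub>R u"] u by simp
    moreover have "r *\<^sub>R u = (r / 2) *\<^sub>R u + (r / 2) *\<^sub>R u"
      by (simp flip: scaleR_add_left)
    ultimately have "(r / 2) *\<^sub>R u - D u = y"
      by (simp add: algebra_simps)
    then show "\<exists>u. y = (r / 2) *\<^sub>R u - D u"
      by blast
  qed
  obtain n where n: "2 * M < 2 ^ n"
    using real_arch_pow[of 2 "2 * M"] by auto
  have "surj (\<lambda>x. (2 ^ n) *\<^sub>R x - D x)"
    unfolding surj_def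
  proof
    fix y
    define r :: real where "r = 2 ^ n"
    have r: "0 < r" "2 * M \<le> r"
      using n by (auto simp: r_def)
    have "dist ((y + D u) /\<^sub>R r) ((y + D v) /\<^sub>R r) \<le> 1 / 2 * dist u v" for u v
    proof -
      have "norm (D (u - v)) \<le> r / 2 * norm (u - v)"
        using M(2)[of "u - v"] mult_right_mono[of M "r / 2" "norm (u - v)"] r by simp
      then have "inverse r * norm (D u - D v) \<le> 1 / 2 * norm (u - v)"
        using r by (simp add: linear_diff[OF lin] field_simps)
      moreover have "(y + D u) /\<^sub>R r - (y + D v) /\<^sub>R r = (D u - D v) /\<^sub>R r"
        by (simp add: algebra_simps)
      ultimately show ?thesis
        using r by (simp only: dist_norm norm_scaleR) simp
    qed
    then obtain u where u: "(y + D u) /\<^sub>R r = u"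
      using banach_fix_type[of "1 / 2" "\<lambda>u. (y + D u) /\<^sub>R r"] by auto
    have "r *\<^sub>R ((y + D u) /\<^sub>R r) = y + D u"
      using r by simp
    then have "(2 ^ n) *\<^sub>R u - D u = y"
      unfolding u by (simp add: r_def)
    then show "\<exists>u. y = (2 ^ n) *\<^sub>R u - D u"
      by blast
  qed
  then have "surj (\<lambda>x. (1::real) *\<^sub>R x - D x)"
  proof (induction n)
    case (Suc n)
    then show ?case
      using halve[of "2 ^ Suc n"] by simp
  qed simp
  moreover have "inj (\<lambda>x. x - D x)"
  proof (rule injI)
    fix u v
    assume "u - D u = v - D v"
    then show "u = v"
      using expand[of 1 u v] by simp
  qed
  ultimately show ?thesis
    by (simp add: bij_def)
qed

section \<open>The Moore--Penrose inverse of an idempotent\<close>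

lemma is_mp_inverseI:
  assumes "X \<in> adjointable ip" "T \<circ> X \<circ> T = T" "X \<circ> T \<circ> X = X"
    and "is_adjoint ip (T \<circ> X) (T \<circ> X)" "is_adjoint ip (X \<circ> T) (X \<circ> T)"
  shows "is_mp_inverse ip T X"
  using assms by (simp add: is_mp_inverse_def adj_eqI)

lemma is_adjoint_idempotent:
  assumes "is_adjoint ip P Q" "P \<circ> P = P"
  shows "Q \<circ> Q = Q"
  by (metis assms is_adjoint_comp is_adjoint_unique)

lemma bij_idempotent_symmetrization:
  assumes adj: "is_adjoint ip P Q" and idem: "P \<circ> P = P"
  shows "bij (\<lambda>x. P x + Q x - x)"
proof -
  define S D where "S = (\<lambda>x. P x + Q x - x)" and "D = (\<lambda>x. P x - Q x)"
  note adj' = is_adjoint_sym[OF adj]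
  note lin = is_adjoint_linear[OF adj] is_adjoint_linear[OF adj']
  note linear = lin[THEN linear_add] lin[THEN linear_diff]
  have PP: "P (P x) = P x" for x
    using idem by (metis comp_apply)
  have QQ: "Q (Q x) = Q x" for x
    using is_adjoint_idempotent[OF adj idem] by (metis comp_apply)
  have skew: "is_adjoint ip D (\<lambda>x. - D x)"
    using is_adjoint_diff[OF adj adj'] by (simp add: D_def)
  then have skew': "is_adjoint ip (\<lambda>x. - D x) (\<lambda>x. - (- D x))"
    by (simp add: is_adjoint_sym)
  \<comment> \<open>\<open>-D\<close> is skew-adjoint too, and \<open>(1 - D)(1 + D) = S\<^sup>2\<close>.\<close>
  have "bij ((\<lambda>x. x - D x) \<circ> (\<lambda>x. x - (- D x)))"
    by (intro bij_comp bij_one_minus_skew_adjoint skew skew')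
  also have "(\<lambda>x. x - D x) \<circ> (\<lambda>x. x - (- D x)) = S \<circ> S"
    by (rule ext) (simp add: S_def D_def linear PP QQ algebra_simps)
  finally have "bij (S \<circ> S)" .
  then have "inj S" "surj S"
    by (auto simp: bij_def inj_on_def surj_def)
  then have "bij S"
    by (simp add: bij_def)
  then show ?thesis
    by (simp add: S_def)
qed

lemma is_adjoint_inv:
  assumes "bij S" "is_adjoint ip S S"
  shows "is_adjoint ip (inv S) (inv S)"
  unfolding is_adjoint_def
  by (metis assms bij_inv_eq_iff is_adjoint_def)

text \<open>
  With \<open>S = P + P\<^sup>* - 1\<close>, the operators \<open>P S\<^sup>-\<^sup>1\<close> and \<open>S\<^sup>-\<^sup>1 P\<close> are the orthogonal projections onto the
  ranges of \<open>P\<close> and of \<open>P\<^sup>*\<close>; the Moore--Penrose inverse \<open>S\<^sup>-\<^sup>1 P S\<^sup>-\<^sup>1\<close> is the product of the second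
  by the first.
\<close>

lemma mp_inverse_idempotent_exists:
  assumes "P \<in> adjointable ip" and idem: "P \<circ> P = P"
  obtains X where "is_mp_inverse ip P X"
proof -
  obtain Q where adj: "is_adjoint ip P Q"
    using assms(1) by (auto simp: adjointable_def)
  note adj' = is_adjoint_sym[OF adj]
  note lin = is_adjoint_linear[OF adj] is_adjoint_linear[OF adj']
  note linear = lin[THEN linear_add] lin[THEN linear_diff]
  have PP: "P (P x) = P x" for x
    using idem by (metis comp_apply)
  have QQ: "Q (Q x) = Q x" for x
    using is_adjoint_idempotent[OF adj idem] by (metis comp_apply)
  define S where "S = (\<lambda>x. P x + Q x - x)"
  define J where "J = inv S"
  have bij: "bij S"
    unfolding S_def by (rule bij_idempotent_symmetrization[OF adj idem])
  have SJ: "S (J x) = x" and JS: "J (S x) = x" for x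
    using bij by (simp_all add: J_def bij_is_surj surj_f_inv_f bij_is_inj)
  have "is_adjoint ip S S"
    using is_adjoint_diff[OF is_adjoint_add[OF adj adj'] is_adjoint_ident]
    by (simp add: S_def add.commute)
  then have adjJ: "is_adjoint ip J J"
    unfolding J_def by (rule is_adjoint_inv[OF bij])
  \<comment> \<open>All identities below come from moving \<open>P\<close> and \<open>P\<^sup>*\<close> past \<open>S\<close>, hence past \<open>J = S\<^sup>-\<^sup>1\<close>.\<close>
  have PS: "P (S x) = P (Q x)" "S (Q x) = P (Q x)" and SP: "S (P x) = Q (S x)" for x
    by (simp_all add: S_def linear PP QQ)
  have JP: "J (P x) = Q (J x)" for x
    by (metis JS PS SJ)
  have PJ: "P (J x) = J (Q x)" for x
    by (metis JS SP SJ)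
  have PJP: "P (J (P x)) = P x" for x
    by (metis JP PS(1) SJ)
  show ?thesis
  proof (rule that, rule is_mp_inverseI)
    show "J \<circ> P \<circ> J \<in> adjointable ip"
      using is_adjoint_comp[OF is_adjoint_comp[OF adjJ adj] adjJ] by (auto simp: adjointable_def)
    show "P \<circ> (J \<circ> P \<circ> J) \<circ> P = P" "J \<circ> P \<circ> J \<circ> P \<circ> (J \<circ> P \<circ> J) = J \<circ> P \<circ> J"
      by (simp_all add: fun_eq_iff PJP)
    have "P \<circ> (J \<circ> P \<circ> J) = P \<circ> J" "P \<circ> J = J \<circ> Q"
      by (simp_all add: fun_eq_iff PJP) (simp add: PJ)
    then show "is_adjoint ip (P \<circ> (J \<circ> P \<circ> J)) (P \<circ> (J \<circ> P \<circ> J))"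
      using is_adjoint_comp[OF adj adjJ] by simp
    have "J \<circ> P \<circ> J \<circ> P = J \<circ> P" "J \<circ> P = Q \<circ> J"
      by (simp_all add: fun_eq_iff PJP) (simp add: JP)
    then show "is_adjoint ip (J \<circ> P \<circ> J \<circ> P) (J \<circ> P \<circ> J \<circ> P)"
      using is_adjoint_comp[OF adjJ adj] by simp
  qed
qed

section \<open>Operators invertible in a corner\<close>

text \<open>
  Here \<open>T\<close> is invertible in the corner of \<open>P\<close>, with inverse \<open>G\<close>. Since \<open>T = T P\<close> and \<open>G = P G\<close>,
  the inner \<open>X\<close> in \<open>T X G\<close> meets \<open>P\<close> on both sides, and \<open>P X P = P\<close> gives \<open>T X G = T G = P\<close>.
\<close>

lemma is_mp_inverse_corner:
  assumes X: "is_mp_inverse ip P X" and P: "P \<in> adjointable ip" and G: "G \<in> adjointable ip"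
    and TG: "T \<circ> G = P" and GT: "G \<circ> T = P"
    and T: "T \<circ> P = T" "P \<circ> T = T" and PG: "P \<circ> G = G" "G \<circ> P = G"
  shows "is_mp_inverse ip T (X \<circ> G \<circ> X)"
proof -
  have adjX: "X \<in> adjointable ip" and PXP: "P \<circ> X \<circ> P = P" and XPX: "X \<circ> P \<circ> X = X"
    and sa: "adj ip (P \<circ> X) = P \<circ> X" "adj ip (X \<circ> P) = X \<circ> P"
    using X by (auto simp: is_mp_inverse_def)
  have TXG: "T \<circ> X \<circ> G = P"
  proof -
    have "T \<circ> X \<circ> G = T \<circ> (P \<circ> X \<circ> P) \<circ> G"
      by (metis T(1) PG(1) comp_assoc)
    then show ?thesis
      by (simp add: PXP T TG)
  qed
  have GXT: "G \<circ> X \<circ> T = P"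
  proof -
    have "G \<circ> X \<circ> T = G \<circ> (P \<circ> X \<circ> P) \<circ> T"
      by (metis T(2) PG(2) comp_assoc)
    then show ?thesis
      by (simp add: PXP PG GT)
  qed
  have left: "T \<circ> (X \<circ> G \<circ> X) = P \<circ> X"
    by (metis TXG comp_assoc)
  have right: "X \<circ> G \<circ> X \<circ> T = X \<circ> P"
    by (metis GXT comp_assoc)
  show ?thesis
  proof (rule is_mp_inverseI)
    show "X \<circ> G \<circ> X \<in> adjointable ip"
      by (intro adjointable_comp adjX G)
    show "T \<circ> (X \<circ> G \<circ> X) \<circ> T = T"
      unfolding left by (metis PXP T(2) comp_assoc)
    show "X \<circ> G \<circ> X \<circ> T \<circ> (X \<circ> G \<circ> X) = X \<circ> G \<circ> X"
      unfolding right by (metis XPX comp_assoc)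
    show "is_adjoint ip (T \<circ> (X \<circ> G \<circ> X)) (T \<circ> (X \<circ> G \<circ> X))"
      unfolding left using is_adjoint_adj[OF adjointable_comp[OF P adjX]] by (simp add: sa)
    show "is_adjoint ip (X \<circ> G \<circ> X \<circ> T) (X \<circ> G \<circ> X \<circ> T)"
      unfolding right using is_adjoint_adj[OF adjointable_comp[OF adjX P]] by (simp add: sa)
  qed
qed

lemma comp_orthogonal_idempotent_combinations:
  assumes adj: "P1 \<in> adjointable ip" "P2 \<in> adjointable ip"
    and idem: "P1 \<circ> P1 = P1" "P2 \<circ> P2 = P2"
    and orth: "P1 \<circ> P2 = (\<lambda>x. 0)" "P2 \<circ> P1 = (\<lambda>x. 0)"
  shows "(\<lambda>x. P1 x + c *\<^sub>C P2 x) \<circ> (\<lambda>x. P1 x + d *\<^sub>C P2 x) = (\<lambda>x. P1 x + (c * d) *\<^sub>C P2 x)"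
proof -
  note a = adj[THEN is_adjoint_adj]
  show ?thesis
    using idem orth
    by (simp add: fun_eq_iff a[THEN is_adjoint_additive] a[THEN is_adjoint_homogeneous]
        scaleC_0_right scaleC_scaleC)
qed

end

theorem proposition2p4:
  fixes act :: "'e::{complex_normed_vector, banach} \<Rightarrow> 'a::cstar_algebra \<Rightarrow> 'e"
    and ip :: "'e \<Rightarrow> 'e \<Rightarrow> 'a"
    and \<Pi>\<^sub>1 \<Pi>\<^sub>2 :: "'e \<Rightarrow> 'e"
  assumes "hilbert_cstar_module act ip"
    and "\<Pi>\<^sub>1 \<in> adjointable ip" and "\<Pi>\<^sub>2 \<in> adjointable ip"
    and "idempotent \<Pi>\<^sub>1" and "idempotent \<Pi>\<^sub>2"
    and "\<Pi>\<^sub>1 \<circ> \<Pi>\<^sub>2 = (\<lambda>x. 0)" and "\<Pi>\<^sub>2 \<circ> \<Pi>\<^sub>1 = (\<lambda>x. 0)"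
  shows "\<forall>l::complex. l \<noteq> 0 \<longrightarrow>
    mp_invertible ip (\<lambda>x. \<Pi>\<^sub>1 x + l *\<^sub>C \<Pi>\<^sub>2 x) \<and>
    mp_invertible ip (\<lambda>x. \<Pi>\<^sub>1 x + \<Pi>\<^sub>2 x) \<and>
    mp_inverse ip (\<lambda>x. \<Pi>\<^sub>1 x + l *\<^sub>C \<Pi>\<^sub>2 x) =
      mp_inverse ip (\<lambda>x. \<Pi>\<^sub>1 x + \<Pi>\<^sub>2 x) \<circ>
      (\<lambda>x. \<Pi>\<^sub>1 x + (1 / l) *\<^sub>C \<Pi>\<^sub>2 x) \<circ>
      mp_inverse ip (\<lambda>x. \<Pi>\<^sub>1 x + \<Pi>\<^sub>2 x)"
proof (intro allI impI)
  fix l :: complex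
  assume l: "l \<noteq> 0"
  interpret hilbert_cstar_module act ip
    by fact
  \<comment> \<open>\<open>c \<mapsto> L c\<close> is multiplicative, which supplies every identity that the corner lemma needs.\<close>
  define L where "L c = (\<lambda>x. \<Pi>\<^sub>1 x + c *\<^sub>C \<Pi>\<^sub>2 x)" for c
  have L1: "(\<lambda>x. \<Pi>\<^sub>1 x + \<Pi>\<^sub>2 x) = L 1"
    by (simp add: L_def scaleC_one)
  have adj: "L c \<in> adjointable ip" for c
    unfolding L_def by (rule adjointable_add_scaleC) fact+
  have comp: "L c \<circ> L d = L (c * d)" for c d
    unfolding L_def
    by (rule comp_orthogonal_idempotent_combinations) (use assms in \<open>auto simp: idempotent_def\<close>)
  obtain X where X: "is_mp_inverse ip (L 1) X"
    by (rule mp_inverse_idempotent_exists[OF adj[of 1]]) (auto simp: comp)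
  have Y: "is_mp_inverse ip (L l) (X \<circ> L (1 / l) \<circ> X)"
    by (rule is_mp_inverse_corner[OF X]) (use l in \<open>simp_all add: adj comp\<close>)
  show "mp_invertible ip (\<lambda>x. \<Pi>\<^sub>1 x + l *\<^sub>C \<Pi>\<^sub>2 x) \<and>
    mp_invertible ip (\<lambda>x. \<Pi>\<^sub>1 x + \<Pi>\<^sub>2 x) \<and>
    mp_inverse ip (\<lambda>x. \<Pi>\<^sub>1 x + l *\<^sub>C \<Pi>\<^sub>2 x) =
      mp_inverse ip (\<lambda>x. \<Pi>\<^sub>1 x + \<Pi>\<^sub>2 x) \<circ>
      (\<lambda>x. \<Pi>\<^sub>1 x + (1 / l) *\<^sub>C \<Pi>\<^sub>2 x) \<circ>
      mp_inverse ip (\<lambda>x. \<Pi>\<^sub>1 x + \<Pi>\<^sub>2 x)"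
    using X Y mp_inverse_eqI[OF adj X] mp_inverse_eqI[OF adj Y]
    unfolding L1 L_def[symmetric] by (auto simp: mp_invertible_def)
qed

end
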